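(* Let $N\in\mathbb{N}$ and let $A$ be a finite band matrix on $\ell^2(\{1,\dots,N\})$, in block-tridiagonal representation with index set $\{1,\dots,N\}$ and sub- and superdiagonals $\alpha,\gamma$. For $n\in\mathbb{N}$ let $$\varepsilon_n = 2(\|\alpha\|_\infty+\|\gamma\|_\infty)\sin\frac{\pi}{2(n+1)}.$$ Then for all $\varepsilon>0$ and all integers $n$ with $1\le n\le N$, $$\bigcup_{k=0}^{N-n}\mathrm{spec}_{\varepsilon}(AP_{n,k},A^*P_{n,k})\ \subseteq\ \mathrm{spec}_\varepsilon A\ \subseteq\ \bigcup_{k=0}^{N-n}\mathrm{spec}_{\varepsilon+\varepsilon_n}(AP_{n,k},A^*P_{n,k}).$$
   Context: The bandwidth $b$ of a complex square matrix is the largest $|i-j|$ over all positions $(i,j)$ with nonzero entry ($b=0$ for the zero matrix). All vector spaces carry the Euclidean norm. Block-tridiagonal representation: if $b\le 1$ put $d=1$ and $A=(A_{i,j})_{i,j=1}^N$ is an ordinary tridiagonal $N\times N$ matrix. If $b>1$ put $d=b+1$ and group the scalar indices into consecutive blocks of length $d$ (the last block possibly shorter), $N$ being the number of blocks; then $A=(A_{i,j})_{i,j=1}^N$ is block-tridiagonal, with entries $A_{i,j}$ being complex matrices of size $d\times d$ (possibly smaller when $i=N$ or $j=N$). From here on, all indices, columns and supports refer to this representation with index set $\{1,\dots,N\}$. Put $\alpha_i=A_{i+1,i}$ ($1\le i\le N-1$), $\gamma_i=A_{i-1,i}$ ($2\le i\le N$), $\|\alpha\|_\infty=\max_i\|\alpha_i\|$,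 $\|\gamma\|_\infty=\max_i\|\gamma_i\|$ (spectral norms; a maximum over the empty set is $0$). $A^*$ denotes the Banach space adjoint (the transpose matrix, without complex conjugation), so $(\lambda I)^*=\lambda I$. Lower norm: $\nu(B)=\inf\{\|Bx\|:\|x\|=1\}$, the infimum being over $x$ in the domain space of $B$ (for a matrix with at least as many rows as columns this is the smallest singular value). Pseudospectrum: $\mathrm{spec}_\varepsilon A=\{\lambda\in\mathbb{C}:\|(A-\lambda I)^{-1}\|>1/\varepsilon\}$ for $\varepsilon>0$, with $\|B^{-1}\|:=\infty$ if $B$ is not invertible. For $1\le n\le N$ and $0\le k\le N-n$, $BP_{n,k}$ denotes the restriction of $B$ to the vectors supported in $k+\{1,\dots,n\}$, i.e. the matrix formed by columns $k+1,\dots,k+n$ of $B$. For $B=A$ or $B=A^*$, $\mathrm{spec}_\varepsilon(BP_{n,k}):=\{\lambda\in\mathbb{C}:\nu((B-\lambda I)P_{n,k})<\varepsilon\}$. Finally $\mathrm{spec}_\varepsilon(AP_{n,k},A^*P_{n,k}):=\mathrm{spec}_\varepsilon(AP_{n,k})\cup\mathrm{spec}_\varepsilon(A^*P_{n,k})$. *)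

theory Defs
  imports
    "HOL-Analysis.L2_Norm"
    "HOL-Library.Extended_Real"
    "Jordan_Normal_Form.Gauss_Jordan_Elimination"
begin

definition vec_norm :: "complex vec \<Rightarrow> real" where
  "vec_norm x = L2_set (\<lambda>i. cmod (x $ i)) {..<dim_vec x}"

definition mat_norm :: "complex mat \<Rightarrow> real" where
  "mat_norm B = (SUP x\<in>{x \<in> carrier_vec (dim_col B). vec_norm x \<le> 1}. vec_norm (B *\<^sub>v x))"

definition lower_norm :: "complex mat \<Rightarrow> real" where
  "lower_norm B = (INF x\<in>{x \<in> carrier_vec (dim_col B). vec_norm x = 1}. vec_norm (B *\<^sub>v x))"

definition inverse_norm :: "complex mat \<Rightarrow> ereal" where
  "inverse_norm B = (case mat_inverse B of None \<Rightarrow> \<infinity> | Some C \<Rightarrow> ereal (mat_norm C))"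

definition bandwidth :: "complex mat \<Rightarrow> nat" where
  "bandwidth A = Max (insert 0 {nat \<bar>int i - int j\<bar> | i j.
     i < dim_row A \<and> j < dim_col A \<and> A $$ (i, j) \<noteq> 0})"

definition block_len :: "complex mat \<Rightarrow> nat" where
  "block_len A = (if bandwidth A \<le> 1 then 1 else bandwidth A + 1)"

definition num_blocks :: "complex mat \<Rightarrow> nat" where
  "num_blocks A = (dim_row A + block_len A - 1) div block_len A"

text \<open>Scalar indices start at 0 (as usual for \<^typ>\<open>'a mat\<close>), block indices at 1: for block
  length \<open>d\<close>, the block with index \<open>i\<close> consists of the scalar indices from \<open>(i - 1) * d\<close>
  (inclusive) to \<open>i * d\<close> (exclusive), cut off at the size of the matrix.\<close>

definition mat_window :: "complex mat \<Rightarrow> nat \<Rightarrow> nat \<Rightarrow> nat \<Rightarrow> nat \<Rightarrow> complex mat" where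
  "mat_window B r r' c c' = mat (r' - r) (c' - c) (\<lambda>(i, j). B $$ (r + i, c + j))"

definition block :: "nat \<Rightarrow> complex mat \<Rightarrow> nat \<Rightarrow> nat \<Rightarrow> complex mat" where
  "block d B i j = mat_window B ((i - 1) * d) (min (i * d) (dim_row B))
     ((j - 1) * d) (min (j * d) (dim_col B))"

definition subdiag_norm :: "complex mat \<Rightarrow> real" where
  "subdiag_norm A =
     Max (insert 0 ((\<lambda>i. mat_norm (block (block_len A) A (i + 1) i)) ` {1..<num_blocks A}))"

definition superdiag_norm :: "complex mat \<Rightarrow> real" where
  "superdiag_norm A =
     Max (insert 0 ((\<lambda>i. mat_norm (block (block_len A) A (i - 1) i)) ` {2..num_blocks A}))"

definition eps :: "complex mat \<Rightarrow> nat \<Rightarrow> real" where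
  "eps A n = 2 * (subdiag_norm A + superdiag_norm A) * sin (pi / (2 * (real n + 1)))"

definition shifted :: "complex mat \<Rightarrow> complex \<Rightarrow> complex mat" where
  "shifted B z = B - z \<cdot>\<^sub>m 1\<^sub>m (dim_row B)"

definition pseudospec :: "real \<Rightarrow> complex mat \<Rightarrow> complex set" where
  "pseudospec \<epsilon> A = {z. inverse_norm (shifted A z) > ereal (1 / \<epsilon>)}"

text \<open>The matrix \<open>B P\<^bsub>n,k\<^esub>\<close>, formed by the block columns \<open>k + 1, \<dots>, k + n\<close> of \<open>B\<close>.\<close>

definition block_cols :: "nat \<Rightarrow> complex mat \<Rightarrow> nat \<Rightarrow> nat \<Rightarrow> complex mat" where
  "block_cols d B n k = mat_window B 0 (dim_row B) (k * d) (min ((k + n) * d) (dim_col B))"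

definition pseudospec_cols :: "real \<Rightarrow> nat \<Rightarrow> complex mat \<Rightarrow> nat \<Rightarrow> nat \<Rightarrow> complex set" where
  "pseudospec_cols \<epsilon> d B n k = {z. lower_norm (block_cols d (shifted B z) n k) < \<epsilon>}"

text \<open>The Banach space adjoint is the transpose, without complex conjugation; its blocks are those
  of the representation of \<open>A\<close>.\<close>

definition pseudospec_cols_pair :: "real \<Rightarrow> complex mat \<Rightarrow> nat \<Rightarrow> nat \<Rightarrow> complex set" where
  "pseudospec_cols_pair \<epsilon> A n k =
     pseudospec_cols \<epsilon> (block_len A) A n k \<union>
     pseudospec_cols \<epsilon> (block_len A) (transpose_mat A) n k"

end

theory Submission
  imports Defs "Jordan_Normal_Form.Determinant"
begin

text \<open>
  Write \<open>B = A - z I\<close>. Both inclusions rest on the fact that \<open>z\<close> lies in the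
  \<open>\<epsilon>\<close>-pseudospectrum of \<open>A\<close> exactly if some vector satisfies
  \<open>\<parallel>B x\<parallel> < \<epsilon> \<parallel>x\<parallel>\<close> (\<open>pseudospec_iff\<close>), and that \<open>z\<close> lies in the
  pseudospectrum of a set of columns exactly if such an \<open>x\<close> can be found with support in these
  columns (\<open>pseudospec_cols_iff\<close>).

  The left inclusion is then immediate for the columns of \<open>A\<close>. For the transposed matrix it
  follows because inversion commutes with transposition and transposition preserves the spectral
  norm, so that \<open>A\<close> and its transpose have the same pseudospectrum
  (\<open>pseudospec_transpose\<close>).

  For the right inclusion, an approximate null vector \<open>x\<close> of \<open>B\<close> must be localized to \<open>n\<close>
  consecutive blocks (\<open>exists_localized_vec\<close>). Let \<open>w\<^sub>t = sin (t \<pi> / (n + 1))\<close> for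
  \<open>0 \<le> t \<le> n + 1\<close> and \<open>w\<^sub>t = 0\<close> otherwise, and let \<open>y\<^sub>k\<close> arise from \<open>x\<close> by
  multiplying each block with the weight of its position relative to \<open>k\<close>. As \<open>B\<close> is
  block-tridiagonal, \<open>B y\<^sub>k\<close> differs from the equally weighted \<open>B x\<close> only by the two block
  off-diagonals of \<open>A\<close>, applied to \<open>x\<close> and multiplied by differences of neighbouring weights.
  Now take the Euclidean norm over all \<open>k\<close> simultaneously. With \<open>S = \<Sum> w\<^sub>t\<^sup>2\<close> and
  \<open>T = \<Sum> (w\<^sub>t\<^sub>+\<^sub>1 - w\<^sub>t)\<^sup>2\<close> the triangle inequality yields
  \<open>(\<Sum>\<^sub>k \<parallel>B y\<^sub>k\<parallel>\<^sup>2)\<^sup>1\<^sup>/\<^sup>2 \<le> S\<^sup>1\<^sup>/\<^sup>2 \<parallel>B x\<parallel> + T\<^sup>1\<^sup>/\<^sup>2 (\<parallel>\<alpha>\<parallel> + \<parallel>\<gamma>\<parallel>) \<parallel>x\<parallel>\<close>, while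
  \<open>(\<Sum>\<^sub>k \<parallel>y\<^sub>k\<parallel>\<^sup>2)\<^sup>1\<^sup>/\<^sup>2 = S\<^sup>1\<^sup>/\<^sup>2 \<parallel>x\<parallel>\<close>. Since the weights form a Dirichlet eigenvector of
  the discrete Laplacian, \<open>T = (2 sin (\<pi> / (2 (n + 1))))\<^sup>2 S\<close>, which produces exactly the
  constant \<open>\<epsilon>\<^sub>n\<close>. Hence one of the \<open>y\<^sub>k\<close> has to satisfy
  \<open>\<parallel>B y\<^sub>k\<parallel> < (\<epsilon> + \<epsilon>\<^sub>n) \<parallel>y\<^sub>k\<parallel>\<close>. Positions \<open>k\<close> at which the window overlaps only partly
  with the index set cause no trouble: the part that remains is contained in a full window,
  because \<open>n \<le> N\<close>.
\<close>

section \<open>Euclidean and operator norms\<close>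

lemma vec_norm_nonneg [simp]: "0 \<le> vec_norm x"
  by (simp add: vec_norm_def L2_set_nonneg)

lemma vec_norm_power2: "(vec_norm x)\<^sup>2 = (\<Sum>i<dim_vec x. (cmod (x $ i))\<^sup>2)"
  by (simp add: vec_norm_def L2_set_def sum_nonneg)

lemma vec_norm_eq_0_iff: "vec_norm x = 0 \<longleftrightarrow> x = 0\<^sub>v (dim_vec x)"
proof
  assume "x = 0\<^sub>v (dim_vec x)"
  then have "x $ i = 0" if "i < dim_vec x" for i
    using that by (metis index_zero_vec(1))
  then show "vec_norm x = 0" by (simp add: vec_norm_def L2_set_eq_0_iff)
qed (auto simp: vec_norm_def L2_set_eq_0_iff intro!: eq_vecI)

lemma vec_norm_zero [simp]: "vec_norm (0\<^sub>v n) = 0"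
  by (simp add: vec_norm_eq_0_iff)

lemma vec_norm_smult: "vec_norm (c \<cdot>\<^sub>v x) = cmod c * vec_norm x"
  by (auto simp: vec_norm_def norm_mult L2_set_right_distrib intro!: L2_set_cong)

lemma mult_mat_vec_nth:
  fixes B :: "complex mat"
  assumes "i < dim_row B" "dim_vec x = dim_col B"
  shows "(B *\<^sub>v x) $ i = (\<Sum>j<dim_col B. B $$ (i, j) * x $ j)"
  using assms by (simp add: scalar_prod_def lessThan_atLeast0)

text \<open>A crude bound by the sum of the absolute values of all entries. It guarantees that the supremum
  defining \<open>mat_norm\<close> is taken over a bounded set.\<close>

lemma mult_mat_vec_bounded:
  "\<exists>K. \<forall>x\<in>carrier_vec (dim_col B). vec_norm (B *\<^sub>v x) \<le> K * vec_norm x"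
proof (intro exI ballI)
  fix x :: "complex vec" assume x: "x \<in> carrier_vec (dim_col B)"
  have "vec_norm (B *\<^sub>v x) \<le> (\<Sum>i<dim_row B. cmod ((B *\<^sub>v x) $ i))"
    unfolding vec_norm_def dim_mult_mat_vec by (rule L2_set_le_sum) simp
  also have "\<dots> \<le> (\<Sum>i<dim_row B. \<Sum>j<dim_col B. cmod (B $$ (i, j)) * vec_norm x)"
  proof (rule sum_mono)
    fix i assume "i \<in> {..<dim_row B}"
    then have "cmod ((B *\<^sub>v x) $ i) \<le> (\<Sum>j<dim_col B. cmod (B $$ (i, j) * x $ j))"
      using x by (simp only: mult_mat_vec_nth lessThan_iff carrier_vecD norm_sum)
    also have "\<dots> \<le> (\<Sum>j<dim_col B. cmod (B $$ (i, j)) * vec_norm x)"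
      using x member_le_L2_set[of "{..<dim_col B}" _ "\<lambda>i. cmod (x $ i)"]
      by (intro sum_mono) (auto simp: norm_mult vec_norm_def intro!: mult_left_mono)
    finally show "cmod ((B *\<^sub>v x) $ i) \<le> (\<Sum>j<dim_col B. cmod (B $$ (i, j)) * vec_norm x)" .
  qed
  also have "\<dots> = (\<Sum>i<dim_row B. \<Sum>j<dim_col B. cmod (B $$ (i, j))) * vec_norm x"
    by (simp add: sum_distrib_right)
  finally show "vec_norm (B *\<^sub>v x) \<le> (\<Sum>i<dim_row B. \<Sum>j<dim_col B. cmod (B $$ (i, j))) * vec_norm x" .
qed

lemma mat_norm_upper:
  assumes "x \<in> carrier_vec (dim_col B)" "vec_norm x \<le> 1"
  shows "vec_norm (B *\<^sub>v x) \<le> mat_norm B"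
proof -
  obtain K where K: "\<forall>x\<in>carrier_vec (dim_col B). vec_norm (B *\<^sub>v x) \<le> K * vec_norm x"
    using mult_mat_vec_bounded by blast
  have "vec_norm (B *\<^sub>v x) \<le> \<bar>K\<bar>" if "x \<in> carrier_vec (dim_col B)" "vec_norm x \<le> 1" for x
  proof -
    have "vec_norm (B *\<^sub>v x) \<le> K * vec_norm x" using K that by blast
    also have "\<dots> \<le> \<bar>K\<bar> * 1" using that by (intro mult_mono) auto
    finally show ?thesis by simp
  qed
  then have "bdd_above ((\<lambda>x. vec_norm (B *\<^sub>v x)) ` {x \<in> carrier_vec (dim_col B). vec_norm x \<le> 1})"
    by (intro bdd_aboveI2) auto
  then show ?thesis
    unfolding mat_norm_def using assms by (intro cSUP_upper) auto
qed

lemma mat_norm_nonneg: "0 \<le> mat_norm B"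
  using mat_norm_upper[of "0\<^sub>v (dim_col B)" B] order_trans[OF vec_norm_nonneg] by auto

lemma mat_norm_least:
  assumes "\<And>x. x \<in> carrier_vec (dim_col B) \<Longrightarrow> vec_norm x \<le> 1 \<Longrightarrow> vec_norm (B *\<^sub>v x) \<le> K"
  shows "mat_norm B \<le> K"
  unfolding mat_norm_def using assms
  by (intro cSUP_least) (auto intro!: exI[of _ "0\<^sub>v (dim_col B)"])

lemma vec_norm_normalize:
  assumes "x \<noteq> 0\<^sub>v (dim_vec x)"
  shows "vec_norm (complex_of_real (1 / vec_norm x) \<cdot>\<^sub>v x) = 1"
  using assms by (simp add: vec_norm_smult vec_norm_eq_0_iff norm_divide)

lemma vec_norm_mult_normalize:
  assumes "x \<in> carrier_vec (dim_col B)"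
  shows "vec_norm (B *\<^sub>v (complex_of_real (1 / vec_norm x) \<cdot>\<^sub>v x)) = vec_norm (B *\<^sub>v x) / vec_norm x"
  using assms
  by (subst mult_mat_vec[of B "dim_row B" "dim_col B"])
     (auto simp: vec_norm_smult norm_divide)

lemma vec_norm_mult_le:
  assumes x: "x \<in> carrier_vec (dim_col B)"
  shows "vec_norm (B *\<^sub>v x) \<le> mat_norm B * vec_norm x"
proof (cases "x = 0\<^sub>v (dim_vec x)")
  case True
  then have "x $ j = 0" if "j < dim_col B" for j
    using x that by (metis carrier_vecD index_zero_vec(1))
  then have "vec_norm (B *\<^sub>v x) = 0"
    unfolding vec_norm_def using x
    by (simp add: L2_set_eq_0_iff mult_mat_vec_nth del: index_mult_mat_vec)
  then show ?thesis by (simp add: mat_norm_nonneg)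
next
  case False
  then have pos: "0 < vec_norm x" by (simp add: vec_norm_eq_0_iff less_le)
  have "vec_norm (B *\<^sub>v x) / vec_norm x \<le> mat_norm B"
    using mat_norm_upper[of "complex_of_real (1 / vec_norm x) \<cdot>\<^sub>v x" B] x
      vec_norm_normalize[OF False] vec_norm_mult_normalize[OF x] by auto
  then show ?thesis using pos by (simp add: pos_divide_le_eq)
qed

text \<open>Normalizing a vector turns the infimum over the unit sphere into a homogeneous condition. The set
  of columns must be nonempty, since otherwise there is no unit vector and the infimum has no meaning.\<close>

lemma lower_norm_less_iff:
  assumes "0 < dim_col B"
  shows "lower_norm B < \<epsilon> \<longleftrightarrow>
    (\<exists>x\<in>carrier_vec (dim_col B). vec_norm (B *\<^sub>v x) < \<epsilon> * vec_norm x)"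
proof -
  let ?S = "{x \<in> carrier_vec (dim_col B). vec_norm x = 1}"
  let ?e = "unit_vec (dim_col B) 0 :: complex vec"
  have "vec_norm ?e \<noteq> 0"
    unfolding vec_norm_eq_0_iff using assms by auto
  then have "complex_of_real (1 / vec_norm ?e) \<cdot>\<^sub>v ?e \<in> ?S"
    using vec_norm_normalize[of ?e] by (auto simp: vec_norm_eq_0_iff)
  then have ne: "?S \<noteq> {}" by blast
  have "lower_norm B < \<epsilon> \<longleftrightarrow> (\<exists>x\<in>?S. vec_norm (B *\<^sub>v x) < \<epsilon>)"
    unfolding lower_norm_def by (intro cINF_less_iff ne bdd_belowI2[of _ 0]) auto
  also have "\<dots> \<longleftrightarrow> (\<exists>x\<in>carrier_vec (dim_col B). vec_norm (B *\<^sub>v x) < \<epsilon> * vec_norm x)"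
  proof
    assume "\<exists>x\<in>carrier_vec (dim_col B). vec_norm (B *\<^sub>v x) < \<epsilon> * vec_norm x"
    then obtain x where x: "x \<in> carrier_vec (dim_col B)" "vec_norm (B *\<^sub>v x) < \<epsilon> * vec_norm x" by blast
    have nz: "vec_norm x \<noteq> 0"
    proof
      assume "vec_norm x = 0"
      then show False using x(2) vec_norm_nonneg[of "B *\<^sub>v x"] by simp
    qed
    then have "0 < vec_norm x" using vec_norm_nonneg[of x] by linarith
    then have "vec_norm (B *\<^sub>v x) / vec_norm x < \<epsilon>"
      using x(2) by (simp add: pos_divide_less_eq)
    then show "\<exists>x\<in>?S. vec_norm (B *\<^sub>v x) < \<epsilon>"
      using x(1) nz vec_norm_normalize[of x] vec_norm_mult_normalize[OF x(1)]
      by (intro bexI[of _ "complex_of_real (1 / vec_norm x) \<cdot>\<^sub>v x"]) (auto simp: vec_norm_eq_0_iff)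
  qed force
  finally show ?thesis .
qed

section \<open>Pseudospectra through approximate null vectors\<close>

text \<open>With \<open>v = C\<^sup>T y\<close> and \<open>u\<close> its complex conjugate, \<open>\<parallel>v\<parallel>\<^sup>2 = v \<bullet> u = y \<bullet> C u\<close>
  for the bilinear product, and Cauchy-Schwarz bounds this by \<open>\<parallel>y\<parallel> \<parallel>C\<parallel> \<parallel>v\<parallel>\<close>.\<close>

lemma mat_norm_transpose_le: "mat_norm (transpose_mat C) \<le> mat_norm C"
proof (rule mat_norm_least)
  fix y assume y: "y \<in> carrier_vec (dim_col (transpose_mat C))" "vec_norm y \<le> 1"
  let ?v = "transpose_mat C *\<^sub>v y"
  define u where "u = vec (dim_col C) (\<lambda>i. cnj (?v $ i))"
  have u: "u \<in> carrier_vec (dim_col C)" by (simp add: u_def)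
  have nu: "vec_norm u = vec_norm ?v"
    unfolding vec_norm_def u_def by (auto intro!: L2_set_cong)
  have "complex_of_real ((vec_norm ?v)\<^sup>2) = ?v \<bullet> u"
    unfolding vec_norm_power2 scalar_prod_def u_def
    by (auto simp: complex_norm_square lessThan_atLeast0 simp del: of_real_power intro!: sum.cong)
  also have "\<dots> = y \<bullet> (C *\<^sub>v u)"
    using transpose_vec_mult_scalar[of C "dim_row C" "dim_col C" u y] u y by auto
  finally have "(vec_norm ?v)\<^sup>2 = cmod (y \<bullet> (C *\<^sub>v u))"
    by (metis norm_of_real abs_of_nonneg zero_le_power2)
  also have "\<dots> \<le> (\<Sum>i<dim_row C. \<bar>cmod (y $ i)\<bar> * \<bar>cmod ((C *\<^sub>v u) $ i)\<bar>)"
    unfolding scalar_prod_def by (rule order_trans[OF norm_sum]) (simp add: norm_mult lessThan_atLeast0)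
  also have "\<dots> \<le> vec_norm y * vec_norm (C *\<^sub>v u)"
    using L2_set_mult_ineq[of "\<lambda>i. cmod (y $ i)" "\<lambda>i. cmod ((C *\<^sub>v u) $ i)" "{..<dim_row C}"] y
    by (simp add: vec_norm_def)
  also have "\<dots> \<le> 1 * (mat_norm C * vec_norm u)"
    using y u by (intro mult_mono vec_norm_mult_le) auto
  finally have "vec_norm ?v * vec_norm ?v \<le> mat_norm C * vec_norm ?v"
    by (simp add: nu power2_eq_square)
  then show "vec_norm ?v \<le> mat_norm C"
    using mat_norm_nonneg[of C] vec_norm_nonneg[of ?v] by (cases "vec_norm ?v = 0") auto
qed

lemma mat_norm_transpose: "mat_norm (transpose_mat C) = mat_norm C"
  using mat_norm_transpose_le[of C] mat_norm_transpose_le[of "transpose_mat C"] by simp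

lemma mat_inverse_eq_None_iff:
  fixes B :: "'a :: field mat"
  assumes "B \<in> carrier_mat m m"
  shows "mat_inverse B = None \<longleftrightarrow> det B = 0"
proof
  assume "mat_inverse B = None"
  then show "det B = 0"
    using mat_inverse(1)[OF assms, of undefined] det_non_zero_imp_unit[OF assms, of undefined] by auto
next
  assume "det B = 0"
  show "mat_inverse B = None"
  proof (rule ccontr)
    assume "mat_inverse B \<noteq> None"
    then obtain C where "mat_inverse B = Some C" by blast
    from mat_inverse(2)[OF assms this] have "B * C = 1\<^sub>m m" "C \<in> carrier_mat m m" by auto
    then have "det B * det C = 1" by (metis assms det_mult det_one)
    then show False using \<open>det B = 0\<close> by simp
  qed
qed

lemma inverse_norm_transpose:
  assumes B: "B \<in> carrier_mat m m"
  shows "inverse_norm (transpose_mat B) = inverse_norm B"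
proof (cases "mat_inverse B")
  case None
  then have "mat_inverse (transpose_mat B) = None"
    using mat_inverse_eq_None_iff[OF B] mat_inverse_eq_None_iff[of "transpose_mat B" m] B
    by (simp add: det_transpose)
  then show ?thesis using None by (simp add: inverse_norm_def)
next
  case (Some C)
  note C = mat_inverse(2)[OF B Some]
  have "mat_inverse (transpose_mat B) \<noteq> None"
    using mat_inverse_eq_None_iff[OF B] mat_inverse_eq_None_iff[of "transpose_mat B" m] B Some
    by (simp add: det_transpose)
  then obtain D where D: "mat_inverse (transpose_mat B) = Some D" by blast
  have Bt: "transpose_mat B \<in> carrier_mat m m" using B by simp
  note D' = mat_inverse(2)[OF Bt D]
  have Ct: "transpose_mat C \<in> carrier_mat m m" using C by simp
  have "transpose_mat B * transpose_mat C = 1\<^sub>m m"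
    using C B by (metis transpose_mult transpose_one)
  then have "D * (transpose_mat B * transpose_mat C) = D" using D' right_mult_one_mat[of D m m] by simp
  moreover have "D * (transpose_mat B * transpose_mat C) = transpose_mat C"
    using assoc_mult_mat[of D m m "transpose_mat B" m "transpose_mat C" m] D' Bt Ct by simp
  ultimately have "D = transpose_mat C" by simp
  then show ?thesis using Some D by (simp add: inverse_norm_def mat_norm_transpose)
qed

text \<open>For singular \<open>B\<close> a null vector serves as \<open>x\<close>. If \<open>B\<close> has the inverse \<open>C\<close>, then vectors
  \<open>v\<close> on which \<open>C\<close> is large correspond to vectors \<open>x = C v\<close> on which \<open>B\<close> is small.\<close>

lemma inverse_norm_greater_iff:
  assumes B: "B \<in> carrier_mat m m" and \<epsilon>: "0 < \<epsilon>"
  shows "inverse_norm B > ereal (1 / \<epsilon>) \<longleftrightarrow>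
    (\<exists>x\<in>carrier_vec m. vec_norm (B *\<^sub>v x) < \<epsilon> * vec_norm x)"
proof (cases "mat_inverse B")
  case None
  then obtain x where x: "x \<in> carrier_vec m" "x \<noteq> 0\<^sub>v m" "B *\<^sub>v x = 0\<^sub>v m"
    using mat_inverse_eq_None_iff[OF B] det_0_iff_vec_prod_zero[OF B] by blast
  then have "0 < vec_norm x" by (auto simp: less_le vec_norm_eq_0_iff dest: sym)
  then have "vec_norm (B *\<^sub>v x) < \<epsilon> * vec_norm x" using x \<epsilon> by simp
  then show ?thesis using None x(1) by (auto simp: inverse_norm_def)
next
  case (Some C)
  note C = mat_inverse(2)[OF B Some]
  have "1 / \<epsilon> < mat_norm C \<longleftrightarrow> (\<exists>x\<in>carrier_vec m. vec_norm (B *\<^sub>v x) < \<epsilon> * vec_norm x)"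
  proof
    assume "1 / \<epsilon> < mat_norm C"
    then have "\<not> (\<forall>x\<in>carrier_vec (dim_col C). vec_norm x \<le> 1 \<longrightarrow> vec_norm (C *\<^sub>v x) \<le> 1 / \<epsilon>)"
      using mat_norm_least[of C "1 / \<epsilon>"] by fastforce
    then obtain v where v: "v \<in> carrier_vec m" "vec_norm v \<le> 1" "1 / \<epsilon> < vec_norm (C *\<^sub>v v)"
      using C by (auto simp: not_le)
    have "B *\<^sub>v (C *\<^sub>v v) = v"
      using C v B by (metis assoc_mult_mat_vec one_mult_mat_vec)
    moreover have "1 < \<epsilon> * vec_norm (C *\<^sub>v v)" using v(3) \<epsilon> by (simp add: field_simps)
    ultimately show "\<exists>x\<in>carrier_vec m. vec_norm (B *\<^sub>v x) < \<epsilon> * vec_norm x"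
      using v C by (intro bexI[of _ "C *\<^sub>v v"]) auto
  next
    assume "\<exists>x\<in>carrier_vec m. vec_norm (B *\<^sub>v x) < \<epsilon> * vec_norm x"
    then obtain x where x: "x \<in> carrier_vec m" "vec_norm (B *\<^sub>v x) < \<epsilon> * vec_norm x" by blast
    have "C *\<^sub>v (B *\<^sub>v x) = x"
      using C x B by (metis assoc_mult_mat_vec one_mult_mat_vec)
    then have le: "vec_norm x \<le> mat_norm C * vec_norm (B *\<^sub>v x)"
      using vec_norm_mult_le[of "B *\<^sub>v x" C] mult_mat_vec_carrier[OF B x(1)] C by auto
    have "vec_norm x > 0"
      using x(2) \<epsilon> vec_norm_nonneg[of "B *\<^sub>v x"] by (metis less_le_trans not_le mult.commute mult_zero_left order.strict_iff_order vec_norm_nonneg)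
    then have "mat_norm C \<noteq> 0" using le by auto
    then have "mat_norm C > 0" using mat_norm_nonneg[of C] by simp
    then have "vec_norm x < mat_norm C * (\<epsilon> * vec_norm x)"
      using le x(2) by (meson le_less_trans mult_strict_left_mono)
    then have "1 < mat_norm C * \<epsilon>" using \<open>vec_norm x > 0\<close> by simp
    then show "1 / \<epsilon> < mat_norm C" using \<epsilon> by (simp add: field_simps)
  qed
  then show ?thesis using Some by (simp add: inverse_norm_def)
qed

lemma shifted_carrier [simp]: "B \<in> carrier_mat m m \<Longrightarrow> shifted B z \<in> carrier_mat m m"
  by (auto simp: shifted_def)

lemma shifted_transpose:
  "B \<in> carrier_mat m m \<Longrightarrow> shifted (transpose_mat B) z = transpose_mat (shifted B z)"
  by (auto simp: shifted_def intro!: eq_matI)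

lemma pseudospec_transpose:
  "B \<in> carrier_mat m m \<Longrightarrow> pseudospec \<epsilon> (transpose_mat B) = pseudospec \<epsilon> B"
  by (simp add: pseudospec_def shifted_transpose inverse_norm_transpose[OF shifted_carrier])

lemma pseudospec_iff:
  assumes "B \<in> carrier_mat m m" "0 < \<epsilon>"
  shows "z \<in> pseudospec \<epsilon> B \<longleftrightarrow>
    (\<exists>x\<in>carrier_vec m. vec_norm (shifted B z *\<^sub>v x) < \<epsilon> * vec_norm x)"
  using inverse_norm_greater_iff[OF shifted_carrier[OF assms(1)] assms(2)]
  by (simp add: pseudospec_def)

section \<open>Windows and vectors supported in them\<close>

lemma sum_supported_window:
  fixes f :: "nat \<Rightarrow> 'a :: comm_monoid_add"
  assumes "\<And>j. j < m \<Longrightarrow> \<not> (l \<le> j \<and> j < r) \<Longrightarrow> f j = 0" "r \<le> m"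
  shows "(\<Sum>j<r - l. f (l + j)) = (\<Sum>j<m. f j)"
proof -
  have "(\<Sum>j<r - l. f (l + j)) = (\<Sum>j\<in>{l..<r}. f j)"
    by (rule sum.reindex_bij_witness[of _ "\<lambda>j. j - l" "\<lambda>j. l + j"]) auto
  also have "\<dots> = (\<Sum>j<m. f j)"
    using assms by (intro sum.mono_neutral_left) auto
  finally show ?thesis .
qed

lemma vec_norm_window:
  assumes "\<And>j. j < dim_vec y \<Longrightarrow> \<not> (l \<le> j \<and> j < r) \<Longrightarrow> y $ j = 0" "r \<le> dim_vec y"
  shows "vec_norm (vec (r - l) (\<lambda>j. y $ (l + j))) = vec_norm y"
proof (rule power2_eq_imp_eq)
  show "(vec_norm (vec (r - l) (\<lambda>j. y $ (l + j))))\<^sup>2 = (vec_norm y)\<^sup>2"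
    unfolding vec_norm_power2
    using sum_supported_window[of "dim_vec y" l r "\<lambda>j. (cmod (y $ j))\<^sup>2"] assms by simp
qed auto

text \<open>Restricting a vector to a window containing its support is compatible with restricting the matrix
  to the corresponding columns. This lets all later arguments stay in the full space.\<close>

lemma mat_window_mult:
  assumes B: "B \<in> carrier_mat m m" and y: "y \<in> carrier_vec m"
    and supp: "\<And>j. j < m \<Longrightarrow> \<not> (l \<le> j \<and> j < r) \<Longrightarrow> y $ j = 0" and "r \<le> m"
  shows "mat_window B 0 m l r *\<^sub>v vec (r - l) (\<lambda>j. y $ (l + j)) = B *\<^sub>v y"
proof (rule eq_vecI)
  fix i assume "i < dim_vec (B *\<^sub>v y)"
  then have i: "i < m" using B by auto
  have "(mat_window B 0 m l r *\<^sub>v vec (r - l) (\<lambda>j. y $ (l + j))) $ i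
      = (\<Sum>j<r - l. B $$ (i, l + j) * y $ (l + j))"
    using i by (subst mult_mat_vec_nth) (auto simp: mat_window_def)
  also have "\<dots> = (\<Sum>j<m. B $$ (i, j) * y $ j)"
    using supp \<open>r \<le> m\<close> by (intro sum_supported_window) auto
  also have "\<dots> = (B *\<^sub>v y) $ i"
    using i B y by (subst mult_mat_vec_nth) auto
  finally show "(mat_window B 0 m l r *\<^sub>v vec (r - l) (\<lambda>j. y $ (l + j))) $ i = (B *\<^sub>v y) $ i" .
qed (use B in \<open>auto simp: mat_window_def\<close>)

lemma pseudospec_cols_iff:
  assumes B: "B \<in> carrier_mat m m" and kd: "k * d < m" "0 < d" "0 < n"
  shows "z \<in> pseudospec_cols \<epsilon> d B n k \<longleftrightarrow>
    (\<exists>y\<in>carrier_vec m. (\<forall>j<m. \<not> (k * d \<le> j \<and> j < (k + n) * d) \<longrightarrow> y $ j = 0) \<and>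
       vec_norm (shifted B z *\<^sub>v y) < \<epsilon> * vec_norm y)" (is "_ \<longleftrightarrow> ?R")
proof -
  define l where "l = k * d"
  define r where "r = min ((k + n) * d) m"
  define S where "S = shifted B z"
  have S: "S \<in> carrier_mat m m" using B by (simp add: S_def)
  have "k * d < (k + n) * d" using kd by simp
  then have lr: "l < r" "r \<le> m" using kd by (auto simp: l_def r_def)
  have cols: "block_cols d S n k = mat_window S 0 m l r"
    using S by (auto simp: block_cols_def l_def r_def)
  have W: "dim_col (mat_window S 0 m l r) = r - l" by (simp add: mat_window_def)
  have sup: "(k * d \<le> j \<and> j < (k + n) * d) = (l \<le> j \<and> j < r)" if "j < m" for j
    using that by (auto simp: l_def r_def)
  have "z \<in> pseudospec_cols \<epsilon> d B n k \<longleftrightarrow>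
    (\<exists>x\<in>carrier_vec (r - l). vec_norm (mat_window S 0 m l r *\<^sub>v x) < \<epsilon> * vec_norm x)"
    using lower_norm_less_iff[of "mat_window S 0 m l r" \<epsilon>] lr
    by (simp add: pseudospec_cols_def S_def[symmetric] cols W)
  also have "\<dots> \<longleftrightarrow> ?R"
  proof
    assume "\<exists>x\<in>carrier_vec (r - l). vec_norm (mat_window S 0 m l r *\<^sub>v x) < \<epsilon> * vec_norm x"
    then obtain x where x: "x \<in> carrier_vec (r - l)"
      "vec_norm (mat_window S 0 m l r *\<^sub>v x) < \<epsilon> * vec_norm x" by blast
    define y where "y = vec m (\<lambda>j. if l \<le> j \<and> j < r then x $ (j - l) else 0)"
    have xy: "x = vec (r - l) (\<lambda>j. y $ (l + j))"
      using x(1) lr by (auto simp: y_def intro!: eq_vecI)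
    have y: "y \<in> carrier_vec m" "\<And>j. j < m \<Longrightarrow> \<not> (l \<le> j \<and> j < r) \<Longrightarrow> y $ j = 0"
      by (auto simp: y_def)
    have "mat_window S 0 m l r *\<^sub>v x = S *\<^sub>v y"
      unfolding xy by (rule mat_window_mult[OF S y lr(2)])
    moreover have "vec_norm x = vec_norm y"
      unfolding xy by (rule vec_norm_window) (use y lr in auto)
    ultimately show ?R using x(2) y sup by (intro bexI[of _ y]) (auto simp: S_def)
  next
    assume ?R
    then obtain y where y: "y \<in> carrier_vec m" "\<And>j. j < m \<Longrightarrow> \<not> (l \<le> j \<and> j < r) \<Longrightarrow> y $ j = 0"
      "vec_norm (S *\<^sub>v y) < \<epsilon> * vec_norm y" using sup by (auto simp: S_def)
    let ?x = "vec (r - l) (\<lambda>j. y $ (l + j))"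
    have "mat_window S 0 m l r *\<^sub>v ?x = S *\<^sub>v y"
      by (rule mat_window_mult[OF S y(1,2) lr(2)])
    moreover have "vec_norm ?x = vec_norm y"
      by (rule vec_norm_window) (use y lr in auto)
    ultimately show "\<exists>x\<in>carrier_vec (r - l). vec_norm (mat_window S 0 m l r *\<^sub>v x) < \<epsilon> * vec_norm x"
      using y(3) by (intro bexI[of _ ?x]) auto
  qed
  finally show ?thesis .
qed

lemma pseudospec_cols_subset:
  assumes "B \<in> carrier_mat m m" "k * d < m" "0 < d" "0 < n" "0 < \<epsilon>"
  shows "pseudospec_cols \<epsilon> d B n k \<subseteq> pseudospec \<epsilon> B"
  using pseudospec_cols_iff[OF assms(1-4)] pseudospec_iff[OF assms(1,5)] by blast

section \<open>The sine weights\<close>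

text \<open>Summation by parts for the eigenvalue equation
  \<open>2 s\<^sub>j - s\<^sub>j\<^sub>+\<^sub>1 - s\<^sub>j\<^sub>-\<^sub>1 = (2 sin (\<theta>/2))\<^sup>2 s\<^sub>j\<close>. The boundary term at \<open>0\<close> vanishes
  because \<open>sin 0 = 0\<close>; keeping the one at \<open>M\<close> makes the identity provable by induction. For
  \<open>M = n + 1\<close> and \<open>\<theta> = \<pi>/(n + 1)\<close> it vanishes as well.\<close>

lemma sum_power2_diff_sin:
  fixes \<theta> :: real
  defines "s \<equiv> \<lambda>j::nat. sin (real j * \<theta>)"
  shows "(\<Sum>j<M. (s (Suc j) - s j)\<^sup>2)
    = (2 * sin (\<theta> / 2))\<^sup>2 * (\<Sum>j<M. (s j)\<^sup>2) + s M * (s M - sin ((real M - 1) * \<theta>))"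
proof (induction M)
  case 0
  then show ?case by (simp add: s_def)
next
  case (Suc M)
  have c: "(2 * sin (\<theta> / 2))\<^sup>2 = 2 - 2 * cos \<theta>"
    using cos_double_sin[of "\<theta> / 2"] by (simp add: power_mult_distrib)
  have rec: "sin ((real M - 1) * \<theta>) = 2 * cos \<theta> * s M - s (Suc M)"
    by (simp add: s_def algebra_simps sin_diff sin_add)
  have p: "sin ((real (Suc M) - 1) * \<theta>) = s M" by (simp add: s_def)
  show ?case
    unfolding sum.lessThan_Suc Suc.IH c rec p
    by (simp add: power2_eq_square algebra_simps)
qed

text \<open>The weights are indexed by integers so that windows may protrude on either side of the index
  set.\<close>

definition sine_weight :: "nat \<Rightarrow> int \<Rightarrow> real" where
  "sine_weight n t = (if 0 \<le> t \<and> t \<le> int n + 1 then sin (real_of_int t * (pi / (real n + 1))) else 0)"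

lemma sine_weight_outside: "t \<le> 0 \<or> int n + 1 \<le> t \<Longrightarrow> sine_weight n t = 0"
  by (cases "t = int n + 1") (auto simp: sine_weight_def)

lemma sum_sine_weight_diff:
  "(\<Sum>j\<le>n. (sine_weight n (int j + 1) - sine_weight n (int j))\<^sup>2)
    = (2 * sin (pi / (2 * (real n + 1))))\<^sup>2 * (\<Sum>j\<le>n. (sine_weight n (int j))\<^sup>2)"
proof -
  have s: "sine_weight n (int j) = sin (real j * (pi / (real n + 1)))" if "j \<le> Suc n" for j
    using that by (simp add: sine_weight_def)
  have s': "sine_weight n (int j + 1) = sin (real (Suc j) * (pi / (real n + 1)))" if "j \<le> n" for j
    using s[of "Suc j"] that by (simp add: add.commute)
  have "sin (real (Suc n) * (pi / (real n + 1))) = 0" by (simp add: add.commute)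
  then show ?thesis
    using sum_power2_diff_sin[of "pi / (real n + 1)" "Suc n"]
    by (simp add: s s' lessThan_Suc_atMost mult.commute)
qed

text \<open>The range of \<open>k\<close> is chosen so large that, for each block position \<open>p\<close>, all shifts that can
  give a nonzero contribution occur. Therefore the sum does not depend on \<open>p\<close>, even at the ends of
  the index set.\<close>

lemma sum_translates:
  fixes f :: "int \<Rightarrow> real"
  assumes "\<And>t. t < 0 \<or> int n < t \<Longrightarrow> f t = 0" "0 \<le> p" "p \<le> int N"
  shows "(\<Sum>k\<in>{- int n..int N}. f (p - k)) = (\<Sum>j\<le>n. f (int j))"
proof -
  have "(\<Sum>k\<in>{- int n..int N}. f (p - k)) = (\<Sum>k\<in>{p - int n..p}. f (p - k))"
    using assms by (intro sum.mono_neutral_right) auto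
  also have "\<dots> = (\<Sum>j\<le>n. f (int j))"
    by (rule sum.reindex_bij_witness[of _ "\<lambda>j. p - int j" "\<lambda>k. nat (p - k)"]) auto
  finally show ?thesis .
qed


lemma sum_sine_weight_translates:
  assumes "0 \<le> p" "p \<le> int N"
  shows "(\<Sum>k\<in>{- int n..int N}. (sine_weight n (p - k))\<^sup>2) = (\<Sum>j\<le>n. (sine_weight n (int j))\<^sup>2)"
    and "(\<Sum>k\<in>{- int n..int N}. (sine_weight n (p - k + 1) - sine_weight n (p - k))\<^sup>2)
      = (2 * sin (pi / (2 * (real n + 1))))\<^sup>2 * (\<Sum>j\<le>n. (sine_weight n (int j))\<^sup>2)"
proof -
  show "(\<Sum>k\<in>{- int n..int N}. (sine_weight n (p - k))\<^sup>2) = (\<Sum>j\<le>n. (sine_weight n (int j))\<^sup>2)"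
    using assms by (intro sum_translates[where f = "\<lambda>t. (sine_weight n t)\<^sup>2"]) (auto simp: sine_weight_outside)
  show "(\<Sum>k\<in>{- int n..int N}. (sine_weight n (p - k + 1) - sine_weight n (p - k))\<^sup>2)
      = (2 * sin (pi / (2 * (real n + 1))))\<^sup>2 * (\<Sum>j\<le>n. (sine_weight n (int j))\<^sup>2)"
    unfolding sum_sine_weight_diff[symmetric] using assms
    by (intro sum_translates[where f = "\<lambda>t. (sine_weight n (t + 1) - sine_weight n t)\<^sup>2"])
       (auto simp: sine_weight_outside)
qed

section \<open>Localization of approximate null vectors\<close>

text \<open>If the squared weights have the same sum over \<open>k\<close> for each index \<open>i\<close>, the norm of the whole
  weighted family is that of \<open>f\<close> up to a constant. All three terms of the commutator estimate
  are evaluated in this way.\<close>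

lemma L2_set_weighted:
  fixes f :: "'a \<Rightarrow> complex"
  assumes "\<And>i. i \<in> I \<Longrightarrow> (\<Sum>k\<in>K. (c k i)\<^sup>2) = C" "0 \<le> C" "finite K" "finite I"
  shows "L2_set (\<lambda>(k, i). cmod (complex_of_real (c k i) * f i)) (K \<times> I) = sqrt C * L2_set (\<lambda>i. cmod (f i)) I"
proof -
  have "(\<Sum>(k, i)\<in>K \<times> I. (cmod (complex_of_real (c k i) * f i))\<^sup>2) = (\<Sum>i\<in>I. (\<Sum>k\<in>K. (c k i)\<^sup>2) * (cmod (f i))\<^sup>2)"
    by (simp add: sum.cartesian_product[symmetric] sum.swap[of _ I K] sum_distrib_right norm_mult power_mult_distrib)
  also have "\<dots> = C * (\<Sum>i\<in>I. (cmod (f i))\<^sup>2)"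
    using assms by (simp add: sum_distrib_left)
  finally show ?thesis
    unfolding L2_set_def by (simp add: case_prod_unfold real_sqrt_mult)
qed

text \<open>The core of the proof. Here \<open>q\<close> is the block number (counted from \<open>0\<close>) of a scalar index, and
  \<open>a\<close>, \<open>c\<close> bound the parts of \<open>B\<close> below and above the block diagonal, applied to
  \<open>x\<close>. If each localized vector violated the claimed inequality, summing the squares over all
  windows would contradict the triangle inequality for the whole family.\<close>

lemma exists_localized_vec:
  fixes B :: "complex mat" and d n N m :: nat and a c \<epsilon> :: real
  defines "q \<equiv> \<lambda>i. i div d"
  assumes B: "B \<in> carrier_mat m m" and d: "0 < d" and mN: "m \<le> N * d" and n: "1 \<le> n" "n \<le> N"
    and band: "\<And>i j. i < m \<Longrightarrow> j < m \<Longrightarrow> B $$ (i, j) \<noteq> 0 \<Longrightarrow> q i \<le> q j + 1 \<and> q j \<le> q i + 1"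
    and x: "x \<in> carrier_vec m"
    and sub: "L2_set (\<lambda>i. cmod (\<Sum>j | j < m \<and> q j + 1 = q i. B $$ (i, j) * x $ j)) {..<m} \<le> a * vec_norm x"
    and sup: "L2_set (\<lambda>i. cmod (\<Sum>j | j < m \<and> q j = q i + 1. B $$ (i, j) * x $ j)) {..<m} \<le> c * vec_norm x"
    and less: "vec_norm (B *\<^sub>v x) < \<epsilon> * vec_norm x"
  shows "\<exists>k\<in>{0..N - n}. \<exists>y\<in>carrier_vec m.
    (\<forall>j<m. \<not> (k * d \<le> j \<and> j < (k + n) * d) \<longrightarrow> y $ j = 0) \<and>
    vec_norm (B *\<^sub>v y) < (\<epsilon> + 2 * (a + c) * sin (pi / (2 * (real n + 1)))) * vec_norm y"
proof -
  define w where "w = sine_weight n"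
  define \<sigma> where "\<sigma> = sin (pi / (2 * (real n + 1)))"
  define S where "S = (\<Sum>j\<le>n. (w (int j))\<^sup>2)"
  define K where "K = {- int n..int N}"
  define L where "L i = (\<Sum>j | j < m \<and> q j + 1 = q i. B $$ (i, j) * x $ j)" for i
  define U where "U i = (\<Sum>j | j < m \<and> q j = q i + 1. B $$ (i, j) * x $ j)" for i
  define y where "y k = vec m (\<lambda>j. complex_of_real (w (int (q j) + 1 - k)) * x $ j)" for k
  have q: "q i < N" if "i < m" for i
    using that mN d by (simp add: q_def div_less_iff_less_mult mult.commute)
  have \<sigma>: "0 \<le> \<sigma>" unfolding \<sigma>_def
    by (rule sin_ge_zero) (auto simp: field_simps)
  \<comment> \<open>Only \<open>S > 0\<close> is at stake here: it makes the inequality for the family strict.\<close>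
  have w1: "w 1 \<noteq> 0"
  proof -
    have "0 < sin (pi / (real n + 1))" using n by (intro sin_gt_zero) (auto simp: field_simps)
    then show ?thesis by (simp add: w_def sine_weight_def)
  qed
  have S: "0 < S" unfolding S_def
    by (rule sum_pos2[of _ 1]) (use n w1 in auto)
  have y: "y k \<in> carrier_vec m" for k by (simp add: y_def)
  \<comment> \<open>The commutator of \<open>B\<close> with the weights: the block of index \<open>j\<close> equals that of \<open>i\<close>, or is
    its left or right neighbour, whose weight is replaced by that of \<open>i\<close> plus a correction.\<close>
  have By: "(B *\<^sub>v y k) $ i = complex_of_real (w (int (q i) + 1 - k)) * (B *\<^sub>v x) $ i
     + (complex_of_real (w (int (q i) - k) - w (int (q i) + 1 - k)) * L i
      + complex_of_real (w (int (q i) + 2 - k) - w (int (q i) + 1 - k)) * U i)" if i: "i < m" for k i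
  proof -
    have "(B *\<^sub>v y k) $ i = (\<Sum>j<m. B $$ (i, j) * (complex_of_real (w (int (q j) + 1 - k)) * x $ j))"
      using i B by (subst mult_mat_vec_nth) (auto simp: y_def)
    also have "\<dots> = (\<Sum>j<m. complex_of_real (w (int (q i) + 1 - k)) * (B $$ (i, j) * x $ j)
        + ((if q j + 1 = q i then complex_of_real (w (int (q i) - k) - w (int (q i) + 1 - k)) * (B $$ (i, j) * x $ j) else 0)
        + (if q j = q i + 1 then complex_of_real (w (int (q i) + 2 - k) - w (int (q i) + 1 - k)) * (B $$ (i, j) * x $ j) else 0)))"
    proof (rule sum.cong)
      fix j assume "j \<in> {..<m}"
      then consider "B $$ (i, j) = 0" | "q j = q i" | "q j + 1 = q i" | "q j = q i + 1"
        using band[of i j] i by force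
      then show "B $$ (i, j) * (complex_of_real (w (int (q j) + 1 - k)) * x $ j)
        = complex_of_real (w (int (q i) + 1 - k)) * (B $$ (i, j) * x $ j)
        + ((if q j + 1 = q i then complex_of_real (w (int (q i) - k) - w (int (q i) + 1 - k)) * (B $$ (i, j) * x $ j) else 0)
        + (if q j = q i + 1 then complex_of_real (w (int (q i) + 2 - k) - w (int (q i) + 1 - k)) * (B $$ (i, j) * x $ j) else 0))"
      proof cases
        case 3
        then have e: "q i = q j + 1" by simp
        show ?thesis by (simp add: e algebra_simps)
      next
        case 4
        show ?thesis by (simp add: 4 algebra_simps)
      qed auto
    qed simp
    also have "\<dots> = complex_of_real (w (int (q i) + 1 - k)) * (\<Sum>j<m. B $$ (i, j) * x $ j)
     + (complex_of_real (w (int (q i) - k) - w (int (q i) + 1 - k)) * L i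
      + complex_of_real (w (int (q i) + 2 - k) - w (int (q i) + 1 - k)) * U i)"
      unfolding L_def U_def sum.distrib sum_distrib_left
      by (simp add: sum.If_cases Int_def lessThan_def)
    also have "(\<Sum>j<m. B $$ (i, j) * x $ j) = (B *\<^sub>v x) $ i"
      using i B x by (subst mult_mat_vec_nth) auto
    finally show ?thesis .
  qed
  let ?P = "K \<times> {..<m}"
  have C: "(\<Sum>k\<in>K. (w (int (q i) + 1 - k))\<^sup>2) = S"
    "(\<Sum>k\<in>K. (w (int (q i) - k) - w (int (q i) + 1 - k))\<^sup>2) = (2 * \<sigma>)\<^sup>2 * S"
    "(\<Sum>k\<in>K. (w (int (q i) + 2 - k) - w (int (q i) + 1 - k))\<^sup>2) = (2 * \<sigma>)\<^sup>2 * S"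
    if "i \<in> {..<m}" for i
  proof -
    have p: "0 \<le> int (q i)" "int (q i) \<le> int N" "0 \<le> int (q i) + 1" "int (q i) + 1 \<le> int N"
      using q[of i] that by auto
    show "(\<Sum>k\<in>K. (w (int (q i) + 1 - k))\<^sup>2) = S"
      using sum_sine_weight_translates(1)[OF p(3,4)] by (simp add: w_def S_def K_def)
    show "(\<Sum>k\<in>K. (w (int (q i) - k) - w (int (q i) + 1 - k))\<^sup>2) = (2 * \<sigma>)\<^sup>2 * S"
    proof -
      have "(w (int (q i) - k) - w (int (q i) + 1 - k))\<^sup>2 = (w (int (q i) - k + 1) - w (int (q i) - k))\<^sup>2" for k
        by (simp add: power2_commute diff_add_eq)
      then show ?thesis
        using sum_sine_weight_translates(2)[OF p(1,2), of n] by (simp add: w_def S_def K_def \<sigma>_def)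
    qed
    show "(\<Sum>k\<in>K. (w (int (q i) + 2 - k) - w (int (q i) + 1 - k))\<^sup>2) = (2 * \<sigma>)\<^sup>2 * S"
    proof -
      have e: "int (q i) + 1 - k + 1 = int (q i) + 2 - k" for k by simp
      show ?thesis
        using sum_sine_weight_translates(2)[OF p(3,4), of n]
        unfolding w_def S_def K_def \<sigma>_def e .
    qed
  qed
  have fin: "finite K" by (simp add: K_def)
  have norm_family: "L2_set (\<lambda>(k, i). cmod (v k $ i)) ?P = L2_set (\<lambda>k. vec_norm (v k)) K"
    if "\<And>k. dim_vec (v k) = m" for v
    unfolding L2_set_def using that
    by (simp add: case_prod_unfold vec_norm_power2 sum.cartesian_product)
  \<comment> \<open>Minkowski's inequality over all pairs of a window position and a scalar index.\<close>
  have "L2_set (\<lambda>k. vec_norm (B *\<^sub>v y k)) K = L2_set (\<lambda>(k, i). cmod ((B *\<^sub>v y k) $ i)) ?P"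
    using norm_family[of "\<lambda>k. B *\<^sub>v y k"] B by simp
  also have "\<dots> \<le> L2_set (\<lambda>(k, i). cmod (complex_of_real (w (int (q i) + 1 - k)) * (B *\<^sub>v x) $ i)
      + (cmod (complex_of_real (w (int (q i) - k) - w (int (q i) + 1 - k)) * L i)
       + cmod (complex_of_real (w (int (q i) + 2 - k) - w (int (q i) + 1 - k)) * U i))) ?P"
    by (intro L2_set_mono)
       (auto simp: By simp del: index_mult_mat_vec intro!: order_trans[OF norm_triangle_ineq] add_left_mono norm_triangle_ineq)
  also have "\<dots> \<le> L2_set (\<lambda>(k, i). cmod (complex_of_real (w (int (q i) + 1 - k)) * (B *\<^sub>v x) $ i)) ?P
      + (L2_set (\<lambda>(k, i). cmod (complex_of_real (w (int (q i) - k) - w (int (q i) + 1 - k)) * L i)) ?P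
       + L2_set (\<lambda>(k, i). cmod (complex_of_real (w (int (q i) + 2 - k) - w (int (q i) + 1 - k)) * U i)) ?P)"
    unfolding case_prod_unfold
    by (intro order_trans[OF L2_set_triangle_ineq] add_left_mono L2_set_triangle_ineq)
  also have "\<dots> = sqrt S * vec_norm (B *\<^sub>v x) + (sqrt ((2 * \<sigma>)\<^sup>2 * S) * L2_set (\<lambda>i. cmod (L i)) {..<m}
       + sqrt ((2 * \<sigma>)\<^sup>2 * S) * L2_set (\<lambda>i. cmod (U i)) {..<m})"
  proof -
    have N1: "L2_set (\<lambda>(k, i). cmod (complex_of_real (w (int (q i) + 1 - k)) * (B *\<^sub>v x) $ i)) ?P
        = sqrt (S) * L2_set (\<lambda>i. cmod ((B *\<^sub>v x) $ i)) {..<m}"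
      by (rule L2_set_weighted) (use C(1) S fin in auto)
    have N2: "L2_set (\<lambda>(k, i). cmod (complex_of_real (w (int (q i) - k) - w (int (q i) + 1 - k)) * L i)) ?P
        = sqrt ((2 * \<sigma>)\<^sup>2 * S) * L2_set (\<lambda>i. cmod (L i)) {..<m}"
      by (rule L2_set_weighted) (use C(2) S fin in auto)
    have N3: "L2_set (\<lambda>(k, i). cmod (complex_of_real (w (int (q i) + 2 - k) - w (int (q i) + 1 - k)) * U i)) ?P
        = sqrt ((2 * \<sigma>)\<^sup>2 * S) * L2_set (\<lambda>i. cmod (U i)) {..<m}"
      by (rule L2_set_weighted) (use C(3) S fin in auto)
    have "dim_vec (B *\<^sub>v x) = m" using B by simp
    then show ?thesis by (simp only: N1 N2 N3 vec_norm_def)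
  qed
  also have "\<dots> = sqrt S * (vec_norm (B *\<^sub>v x) + 2 * \<sigma> * (L2_set (\<lambda>i. cmod (L i)) {..<m} + L2_set (\<lambda>i. cmod (U i)) {..<m}))"
    using \<sigma> by (simp add: real_sqrt_mult algebra_simps)
  also have "\<dots> < sqrt S * (\<epsilon> * vec_norm x + 2 * \<sigma> * (a * vec_norm x + c * vec_norm x))"
    using S \<sigma> less sub sup unfolding L_def[symmetric] U_def[symmetric]
    by (intro mult_strict_left_mono add_less_le_mono mult_left_mono add_mono) auto
  also have "\<dots> = (\<epsilon> + 2 * (a + c) * \<sigma>) * (sqrt S * vec_norm x)"
    by (simp add: algebra_simps)
  also have "sqrt S * vec_norm x = L2_set (\<lambda>(k, i). cmod (y k $ i)) ?P"
  proof -
    have "L2_set (\<lambda>(k, i). cmod (y k $ i)) ?P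
      = L2_set (\<lambda>(k, i). cmod (complex_of_real (w (int (q i) + 1 - k)) * x $ i)) ?P"
      by (intro L2_set_cong) (auto simp: y_def)
    also have "\<dots> = sqrt S * L2_set (\<lambda>i. cmod (x $ i)) {..<m}"
      using S fin C by (intro L2_set_weighted) auto
    finally show ?thesis using x by (simp add: vec_norm_def)
  qed
  also have "\<dots> = L2_set (\<lambda>k. vec_norm (y k)) K"
    by (rule norm_family) (simp add: y_def)
  finally have main: "L2_set (\<lambda>k. vec_norm (B *\<^sub>v y k)) K < (\<epsilon> + 2 * (a + c) * \<sigma>) * L2_set (\<lambda>k. vec_norm (y k)) K" .
  have "\<exists>k\<in>K. vec_norm (B *\<^sub>v y k) < (\<epsilon> + 2 * (a + c) * \<sigma>) * vec_norm (y k)"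
  proof (rule ccontr)
    assume "\<not> ?thesis"
    then have *: "(\<epsilon> + 2 * (a + c) * \<sigma>) * vec_norm (y k) \<le> vec_norm (B *\<^sub>v y k)" if "k \<in> K" for k
      using that by (auto simp: not_less)
    \<comment> \<open>The factor can be pulled into the norm only if it is nonnegative; the inequality \<open>main\<close>
      itself excludes the other case.\<close>
    have E: "0 \<le> \<epsilon> + 2 * (a + c) * \<sigma>"
    proof (rule ccontr)
      assume "\<not> ?thesis"
      then have "(\<epsilon> + 2 * (a + c) * \<sigma>) * L2_set (\<lambda>k. vec_norm (y k)) K \<le> 0"
        by (intro mult_nonpos_nonneg) auto
      then show False using main L2_set_nonneg[of "\<lambda>k. vec_norm (B *\<^sub>v y k)" K] by linarith
    qed
    have "(\<epsilon> + 2 * (a + c) * \<sigma>) * L2_set (\<lambda>k. vec_norm (y k)) K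
      = L2_set (\<lambda>k. (\<epsilon> + 2 * (a + c) * \<sigma>) * vec_norm (y k)) K"
      by (rule L2_set_right_distrib[OF E])
    also have "\<dots> \<le> L2_set (\<lambda>k. vec_norm (B *\<^sub>v y k)) K"
      using * E by (intro L2_set_mono) auto
    finally show False using main by simp
  qed
  then obtain k where k: "vec_norm (B *\<^sub>v y k) < (\<epsilon> + 2 * (a + c) * \<sigma>) * vec_norm (y k)" by blast
  \<comment> \<open>Clamping \<open>k\<close> moves a protruding window inside, covering what it had in common with the
    index set.\<close>
  define k' where "k' = min (nat k) (N - n)"
  have supp: "y k $ j = 0" if j: "j < m" "\<not> (k' * d \<le> j \<and> j < (k' + n) * d)" for j
  proof -
    have "k' * d \<le> j \<longleftrightarrow> k' \<le> q j" "j < (k' + n) * d \<longleftrightarrow> q j < k' + n"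
      using d by (simp_all add: q_def less_eq_div_iff_mult_less_eq div_less_iff_less_mult)
    then have "\<not> (k' \<le> q j \<and> q j < k' + n)" using j(2) by simp
    then have "int (q j) + 1 - k \<le> 0 \<or> int n + 1 \<le> int (q j) + 1 - k"
      using q[OF j(1)] n unfolding k'_def by linarith
    then have "w (int (q j) + 1 - k) = 0" by (simp add: w_def sine_weight_outside)
    then show ?thesis using j(1) by (simp add: y_def)
  qed
  show ?thesis
    using supp k y[of k] unfolding \<sigma>_def
    by (intro bexI[of _ k'] bexI[of _ "y k"]) (auto simp: k'_def)
qed

section \<open>Norms of the block diagonals\<close>

text \<open>A block matrix with at most one block in each block row and each block column acts on the blocks of
  \<open>x\<close> separately, so its norm is at most the largest norm of its blocks. The nonzero blocks are
  at the positions \<open>(p, g p)\<close> with \<open>p \<in> P\<close>; injectivity of \<open>g\<close> ensures that no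
  block of \<open>x\<close> is counted twice. Positions start at \<open>0\<close>, but the arguments of \<open>block\<close> start at
  \<open>1\<close>.\<close>

lemma block_diagonal_bound:
  fixes A :: "complex mat" and d N m :: nat and g :: "nat \<Rightarrow> nat" and P :: "nat set"
  defines "q \<equiv> \<lambda>i. i div d"
  assumes A: "A \<in> carrier_mat m m" and d: "0 < d" and mN: "m \<le> N * d"
    and g: "inj_on g P" "P \<subseteq> {..<N}" "g ` P \<subseteq> {..<N}"
    and a: "\<And>p. p \<in> P \<Longrightarrow> mat_norm (block d A (p + 1) (g p + 1)) \<le> a" "0 \<le> a"
    and x: "x \<in> carrier_vec m"
  shows "L2_set (\<lambda>i. cmod (\<Sum>j | j < m \<and> q i \<in> P \<and> q j = g (q i). A $$ (i, j) * x $ j)) {..<m}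
    \<le> a * vec_norm x"
proof -
  define I where "I p = {i. i < m \<and> q i = p}" for p
  have q: "q i < N" if "i < m" for i
    using that mN d by (simp add: q_def div_less_iff_less_mult mult.commute)
  have I: "i \<in> I p \<longleftrightarrow> p * d \<le> i \<and> i < min ((p + 1) * d) m" for i p
  proof -
    have "p * d \<le> i \<longleftrightarrow> p \<le> q i" "i < (p + 1) * d \<longleftrightarrow> q i < p + 1"
      using d by (simp_all only: q_def less_eq_div_iff_mult_less_eq div_less_iff_less_mult)
    then show ?thesis by (auto simp: I_def)
  qed
  have shift: "(\<Sum>i<min ((p + 1) * d) m - p * d. f (p * d + i)) = (\<Sum>i\<in>I p. f i)"
    for p and f :: "nat \<Rightarrow> 'z :: comm_monoid_add"
    by (rule sum.reindex_bij_witness[of _ "\<lambda>i. i - p * d" "\<lambda>i. p * d + i"]) (auto simp: I)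
  have group: "(\<Sum>p<N. \<Sum>i\<in>I p. h i) = (\<Sum>i<m. h i)" for h :: "nat \<Rightarrow> real"
    using sum.group[of "{..<m}" "{..<N}" q h] q by (auto simp: I_def)
  define X where "X p = (\<Sum>j\<in>I p. (cmod (x $ j))\<^sup>2)" for p
  define R where "R i = (\<Sum>j | j < m \<and> q i \<in> P \<and> q j = g (q i). A $$ (i, j) * x $ j)" for i
  have row: "(\<Sum>i\<in>I p. (cmod (R i))\<^sup>2) \<le> (if p \<in> P then a\<^sup>2 * X (g p) else 0)" if "p < N" for p
  proof (cases "p \<in> P")
    case False
    then have "R i = 0" if "i \<in> I p" for i using that by (simp add: R_def I_def)
    then show ?thesis using False by simp
  next
    case True
    define M where "M = block d A (p + 1) (g p + 1)"
    let ?r = "min ((p + 1) * d) m - p * d" and ?c = "min ((g p + 1) * d) m - g p * d"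
    define v where "v = vec ?c (\<lambda>j. x $ (g p * d + j))"
    have dim_M: "dim_row M = ?r" "dim_col M = ?c"
      using A by (auto simp: M_def block_def mat_window_def)
    have v: "v \<in> carrier_vec (dim_col M)" by (simp add: v_def dim_M)
    have Mv: "(M *\<^sub>v v) $ i = R (p * d + i)" if "i < ?r" for i
    proof -
      have iI: "p * d + i \<in> I p" using that by (auto simp: I)
      have "(M *\<^sub>v v) $ i = (\<Sum>j<?c. A $$ (p * d + i, g p * d + j) * x $ (g p * d + j))"
        using that dim_M v A by (subst mult_mat_vec_nth) (auto simp: v_def M_def block_def mat_window_def)
      also have "\<dots> = (\<Sum>j\<in>I (g p). A $$ (p * d + i, j) * x $ j)"
        by (rule shift)
      also have "\<dots> = R (p * d + i)"
        using iI True by (simp add: R_def I_def)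
      finally show ?thesis .
    qed
    have "(\<Sum>i\<in>I p. (cmod (R i))\<^sup>2) = (vec_norm (M *\<^sub>v v))\<^sup>2"
      unfolding vec_norm_power2 shift[symmetric] dim_mult_mat_vec dim_M(1)
      by (intro sum.cong) (simp_all add: Mv del: index_mult_mat_vec)
    also have "\<dots> \<le> (a * vec_norm v)\<^sup>2"
      using vec_norm_mult_le[OF v] a(1)[OF True, folded M_def]
      by (intro power_mono order_trans[OF _ mult_right_mono[of _ a]]) auto
    also have "\<dots> = a\<^sup>2 * X (g p)"
      unfolding power_mult_distrib vec_norm_power2 X_def shift[symmetric] by (simp add: v_def)
    finally show ?thesis using True by simp
  qed
  have "(\<Sum>i<m. (cmod (R i))\<^sup>2) \<le> (\<Sum>p<N. if p \<in> P then a\<^sup>2 * X (g p) else 0)"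
    unfolding group[symmetric] by (intro sum_mono row) auto
  also have "\<dots> = (\<Sum>p\<in>P. a\<^sup>2 * X (g p))"
    using g(2) by (simp add: sum.If_cases Int_absorb1)
  also have "\<dots> = a\<^sup>2 * (\<Sum>p\<in>g ` P. X p)"
    using g(1) by (simp add: sum.reindex sum_distrib_left)
  also have "\<dots> \<le> a\<^sup>2 * (\<Sum>p<N. X p)"
    using g(3) by (intro mult_left_mono sum_mono2) (auto simp: X_def sum_nonneg)
  also have "\<dots> = (a * vec_norm x)\<^sup>2"
    using x by (simp add: X_def group power_mult_distrib vec_norm_power2)
  finally have "sqrt (\<Sum>i<m. (cmod (R i))\<^sup>2) \<le> a * vec_norm x"
    using a(2) by (intro real_le_lsqrt) (auto simp: sum_nonneg)
  then show ?thesis by (simp add: L2_set_def R_def)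
qed

lemma bandwidth_ge:
  assumes "i < dim_row A" "j < dim_col A" "A $$ (i, j) \<noteq> 0"
  shows "nat \<bar>int i - int j\<bar> \<le> bandwidth A"
proof -
  have "finite ((\<lambda>(i, j). nat \<bar>int i - int j\<bar>) ` ({..<dim_row A} \<times> {..<dim_col A}))" by simp
  then have "finite {nat \<bar>int i - int j\<bar> | i j. i < dim_row A \<and> j < dim_col A \<and> A $$ (i, j) \<noteq> 0}"
    by (rule rev_finite_subset) auto
  then show ?thesis
    unfolding bandwidth_def using assms by (intro Max_ge) auto
qed

lemma block_len_pos: "0 < block_len A"
  by (simp add: block_len_def)

lemma block_tridiagonal:
  assumes "i < dim_row A" "j < dim_col A" "A $$ (i, j) \<noteq> 0"
  shows "i div block_len A \<le> j div block_len A + 1"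
    and "j div block_len A \<le> i div block_len A + 1"
proof -
  have le: "i \<le> j + block_len A" "j \<le> i + block_len A"
    using bandwidth_ge[OF assms] by (auto simp: block_len_def split: if_splits)
  show "i div block_len A \<le> j div block_len A + 1" "j div block_len A \<le> i div block_len A + 1"
    using div_le_mono[OF le(1), of "block_len A"] div_le_mono[OF le(2), of "block_len A"]
      block_len_pos[of A] by auto
qed

lemma num_blocks_bounds:
  shows "dim_row A \<le> num_blocks A * block_len A"
    and "k < num_blocks A \<Longrightarrow> k * block_len A < dim_row A"
proof -
  let ?d = "block_len A" and ?s = "dim_row A + block_len A - 1"
  have d: "0 < ?d" by (rule block_len_pos)
  have "?s < (num_blocks A + 1) * ?d"
    unfolding num_blocks_def using d by (simp only: div_less_iff_less_mult[symmetric] less_add_one)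
  then show "dim_row A \<le> num_blocks A * ?d" by (simp add: algebra_simps)
  assume "k < num_blocks A"
  then have "k + 1 \<le> ?s div ?d" by (simp add: num_blocks_def)
  then have "(k + 1) * ?d \<le> ?s" using d by (simp only: less_eq_div_iff_mult_less_eq)
  then show "k * ?d < dim_row A" using d by (simp add: algebra_simps)
qed

lemma subdiag_bound:
  assumes A: "A \<in> carrier_mat m m" and x: "x \<in> carrier_vec m"
  shows "L2_set (\<lambda>i. cmod (\<Sum>j | j < m \<and> j div block_len A + 1 = i div block_len A. A $$ (i, j) * x $ j)) {..<m}
    \<le> subdiag_norm A * vec_norm x"
proof -
  let ?d = "block_len A" and ?N = "num_blocks A"
  have "mat_norm (block ?d A (p + 1) (p - 1 + 1)) \<le> subdiag_norm A" if "p \<in> {1..<?N}" for p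
    unfolding subdiag_norm_def using that
    by (intro Max_ge) (auto intro!: image_eqI[of _ _ p])
  moreover have "0 \<le> subdiag_norm A" unfolding subdiag_norm_def by (intro Max_ge) auto
  moreover have "inj_on (\<lambda>p. p - 1) {1..<?N}" by (auto simp: inj_on_def)
  ultimately have "L2_set (\<lambda>i. cmod (\<Sum>j | j < m \<and> i div ?d \<in> {1..<?N} \<and> j div ?d = i div ?d - 1. A $$ (i, j) * x $ j)) {..<m}
    \<le> subdiag_norm A * vec_norm x"
    using num_blocks_bounds(1)[of A] A
    by (intro block_diagonal_bound[OF A block_len_pos _ _ _ _ _ _ x, where N = ?N]) auto
  moreover have "{j. j < m \<and> i div ?d \<in> {1..<?N} \<and> j div ?d = i div ?d - 1} = {j. j < m \<and> j div ?d + 1 = i div ?d}"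
    if "i < m" for i
  proof -
    have "i div ?d < ?N"
      using that num_blocks_bounds(1)[of A] A block_len_pos[of A] by (simp add: div_less_iff_less_mult)
    then show ?thesis by auto
  qed
  ultimately show ?thesis by (simp cong: L2_set_cong_simp)
qed

lemma superdiag_bound:
  assumes A: "A \<in> carrier_mat m m" and x: "x \<in> carrier_vec m"
  shows "L2_set (\<lambda>i. cmod (\<Sum>j | j < m \<and> j div block_len A = i div block_len A + 1. A $$ (i, j) * x $ j)) {..<m}
    \<le> superdiag_norm A * vec_norm x"
proof -
  let ?d = "block_len A" and ?N = "num_blocks A"
  have "mat_norm (block ?d A (p + 1) (p + 1 + 1)) \<le> superdiag_norm A" if "p \<in> {..<?N - 1}" for p
    unfolding superdiag_norm_def using that
    by (intro Max_ge) (auto intro!: image_eqI[of _ _ "p + 2"])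
  moreover have "0 \<le> superdiag_norm A" unfolding superdiag_norm_def by (intro Max_ge) auto
  moreover have "inj_on (\<lambda>p::nat. p + 1) {..<?N - 1}" by (auto simp: inj_on_def)
  ultimately have "L2_set (\<lambda>i. cmod (\<Sum>j | j < m \<and> i div ?d \<in> {..<?N - 1} \<and> j div ?d = i div ?d + 1. A $$ (i, j) * x $ j)) {..<m}
    \<le> superdiag_norm A * vec_norm x"
    using num_blocks_bounds(1)[of A] A
    by (intro block_diagonal_bound[OF A block_len_pos _ _ _ _ _ _ x, where N = ?N]) auto
  moreover have "{j. j < m \<and> i div ?d \<in> {..<?N - 1} \<and> j div ?d = i div ?d + 1} = {j. j < m \<and> j div ?d = i div ?d + 1}" for i
  proof -
    have "j div ?d < ?N" if "j < m" for j
      using that num_blocks_bounds(1)[of A] A block_len_pos[of A] by (simp add: div_less_iff_less_mult)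
    then show ?thesis by force
  qed
  ultimately show ?thesis by simp
qed

section \<open>The two inclusions\<close>

text \<open>The shift by \<open>z\<close> changes diagonal entries only, so the block structure and the off-diagonal
  blocks of \<open>A\<close> are inherited by the matrix whose approximate null vector is localized.\<close>

lemma pseudospec_subset_localized:
  assumes A: "A \<in> carrier_mat m m" and n: "1 \<le> n" "n \<le> num_blocks A" and \<epsilon>: "0 < \<epsilon>"
  shows "pseudospec \<epsilon> A
    \<subseteq> (\<Union>k\<in>{0..num_blocks A - n}. pseudospec_cols (\<epsilon> + eps A n) (block_len A) A n k)"
proof
  fix z assume "z \<in> pseudospec \<epsilon> A"
  then obtain x where x: "x \<in> carrier_vec m" "vec_norm (shifted A z *\<^sub>v x) < \<epsilon> * vec_norm x"
    using pseudospec_iff[OF A \<epsilon>] by blast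
  let ?d = "block_len A" and ?N = "num_blocks A" and ?B = "shifted A z"
  have off: "?B $$ (i, j) = A $$ (i, j)" if "i < m" "j < m" "i \<noteq> j" for i j
    using that A by (simp add: shifted_def)
  have mN: "m \<le> ?N * ?d" using num_blocks_bounds(1)[of A] A by simp
  have band: "i div ?d \<le> j div ?d + 1 \<and> j div ?d \<le> i div ?d + 1"
    if "i < m" "j < m" "?B $$ (i, j) \<noteq> 0" for i j
    using block_tridiagonal[of i A j] off[of i j] that A by (cases "i = j") auto
  have "(\<Sum>j | j < m \<and> j div ?d + 1 = i div ?d. ?B $$ (i, j) * x $ j)
      = (\<Sum>j | j < m \<and> j div ?d + 1 = i div ?d. A $$ (i, j) * x $ j)" if "i < m" for i
  proof (rule sum.cong[OF refl])
    fix j assume j: "j \<in> {j. j < m \<and> j div ?d + 1 = i div ?d}"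
    then have "i \<noteq> j" by auto
    then show "?B $$ (i, j) * x $ j = A $$ (i, j) * x $ j" using off[OF that] j by simp
  qed
  then have sub: "L2_set (\<lambda>i. cmod (\<Sum>j | j < m \<and> j div ?d + 1 = i div ?d. ?B $$ (i, j) * x $ j)) {..<m}
      \<le> subdiag_norm A * vec_norm x"
    using subdiag_bound[OF A x(1)] by (simp cong: L2_set_cong_simp)
  have "(\<Sum>j | j < m \<and> j div ?d = i div ?d + 1. ?B $$ (i, j) * x $ j)
      = (\<Sum>j | j < m \<and> j div ?d = i div ?d + 1. A $$ (i, j) * x $ j)" if "i < m" for i
  proof (rule sum.cong[OF refl])
    fix j assume j: "j \<in> {j. j < m \<and> j div ?d = i div ?d + 1}"
    then have "i \<noteq> j" by auto
    then show "?B $$ (i, j) * x $ j = A $$ (i, j) * x $ j" using off[OF that] j by simp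
  qed
  then have sup: "L2_set (\<lambda>i. cmod (\<Sum>j | j < m \<and> j div ?d = i div ?d + 1. ?B $$ (i, j) * x $ j)) {..<m}
      \<le> superdiag_norm A * vec_norm x"
    using superdiag_bound[OF A x(1)] by (simp cong: L2_set_cong_simp)
  obtain k y where k: "k \<in> {0..?N - n}" and y: "y \<in> carrier_vec m"
    "\<forall>j<m. \<not> (k * ?d \<le> j \<and> j < (k + n) * ?d) \<longrightarrow> y $ j = 0"
    "vec_norm (?B *\<^sub>v y) < (\<epsilon> + eps A n) * vec_norm y"
    using exists_localized_vec[OF shifted_carrier[OF A] block_len_pos mN n band x(1) sub sup x(2)]
    unfolding eps_def by blast
  have "k * ?d < m" using k n num_blocks_bounds(2)[of k A] A by auto
  then have "z \<in> pseudospec_cols (\<epsilon> + eps A n) ?d A n k"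
    using pseudospec_cols_iff[OF A _ block_len_pos] n y by auto
  then show "z \<in> (\<Union>k\<in>{0..?N - n}. pseudospec_cols (\<epsilon> + eps A n) ?d A n k)" using k by blast
qed

theorem proposition6p2:
  fixes A :: "complex mat" and m N n :: nat and \<epsilon> :: real
  assumes "A \<in> carrier_mat m m"
    and "N = num_blocks A" and "1 \<le> N"
    and "0 < \<epsilon>"
    and "1 \<le> n" and "n \<le> N"
  shows "(\<Union>k\<in>{0..N - n}. pseudospec_cols_pair \<epsilon> A n k) \<subseteq> pseudospec \<epsilon> A
    \<and> pseudospec \<epsilon> A \<subseteq> (\<Union>k\<in>{0..N - n}. pseudospec_cols_pair (\<epsilon> + eps A n) A n k)"
proof
  note A = assms(1)
  have At: "transpose_mat A \<in> carrier_mat m m" using A by simp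
  show "(\<Union>k\<in>{0..N - n}. pseudospec_cols_pair \<epsilon> A n k) \<subseteq> pseudospec \<epsilon> A"
  proof (rule UN_least)
    fix k assume "k \<in> {0..N - n}"
    then have "k * block_len A < m"
      using num_blocks_bounds(2)[of k A] assms by auto
    then show "pseudospec_cols_pair \<epsilon> A n k \<subseteq> pseudospec \<epsilon> A"
      using pseudospec_cols_subset[OF A, of k "block_len A" n \<epsilon>]
        pseudospec_cols_subset[OF At, of k "block_len A" n \<epsilon>] block_len_pos[of A] assms
      by (simp add: pseudospec_cols_pair_def pseudospec_transpose[OF A])
  qed
  show "pseudospec \<epsilon> A \<subseteq> (\<Union>k\<in>{0..N - n}. pseudospec_cols_pair (\<epsilon> + eps A n) A n k)"
    using pseudospec_subset_localized[OF A, of n \<epsilon>] assms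
    unfolding pseudospec_cols_pair_def by blast
qed

end
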